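(* Let $A\in\mathbb{R}^{n\times n}$, $C\in\mathbb{R}^{q\times n}$, and let $F\in\mathbb{R}^{r\times n}$ ($r\le n$) have linearly independent rows. Let $\mathcal{O}_F\subseteq\mathbb{R}^r$ be the functionally observable set of the system $(C,A;F)$ and let $\mathcal{C}_F\subseteq\mathbb{R}^r$ be the output controllable set of the dual system $(A^{\mathsf T},C^{\mathsf T};F)$. Let $W=\int_0^{t_1}e^{A^{\mathsf T}\tau}C^{\mathsf T}Ce^{A\tau}\,d\tau$. Then $\mathcal{O}_F=\mathcal{C}_F$ if and only if $F\operatorname{Im}(W)\perp F\operatorname{Ker}(W)$. Under this condition, $(C,A;F)$ is functionally observable if and only if $(A^{\mathsf T},C^{\mathsf T};F)$ is output controllable.
   Context: Fix a final time $t_1>0$. Consider linear time-invariant systems $\dot{x}=\mathsf{A}x+\mathsf{B}u$, $y=\mathsf{C}x$, with target vector $z=Fx\in\mathbb{R}^r$. Output controllability. The triple $(\mathsf{A},\mathsf{B};F)$ denotes the system with system matrix $\mathsf{A}$, input matrix $\mathsf{B}$ and functional matrix $F$. Its output controllable set is the set of all $z^*\in\mathbb{R}^r$ for which there is an input $u(t)$, $t\in[0,t_1]$, steering the system from $x(0)=0$ to some $x(t_1)$ with $Fx(t_1)=z^*$. Equivalently, it is $F\operatorname{Im}(W_c)$ with $W_c=\int_0^{t_1}e^{\mathsf{A}(t_1-\tau)}\mathsf{B}\mathsf{B}^{\mathsf T}e^{\mathsf{A}^{\mathsf T}(t_1-\tau)}\,d\tau$. The system is output controllable when this set equals $\mathbb{R}^r$;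 equivalently $\operatorname{rank}(F[\mathsf{B}\ \mathsf{A}\mathsf{B}\ \cdots\ \mathsf{A}^{n-1}\mathsf{B}])=\operatorname{rank}(F)$. Here the system considered is the dual one: $\mathsf{A}=A^{\mathsf T}$, $\mathsf{B}=C^{\mathsf T}$, for which $W_c=W$. Functional observability. The triple $(C,A;F)$ denotes the system with output matrix $C$, system matrix $A$ and functional matrix $F$. Its functionally observable set $\mathcal{O}_F$ is the set of all $z^*\in\mathbb{R}^r$ such that $z(0)=Fx(0)=z^*$ can be uniquely determined from the output $y(t)$ and input $u(t)$ over $[0,t_1]$; explicitly, $$\mathcal{O}_F=\{z^*\in\mathbb{R}^r:\ z^*\perp F\operatorname{Ker}(W)\ \text{and}\ z^*\in F\operatorname{Im}(W)\}.$$ The system is functionally observable when $\mathcal{O}_F=\mathbb{R}^r$; equivalently $\operatorname{rank}\begin{bmatrix}\mathcal{O}\\ F\end{bmatrix}=\operatorname{rank}(\mathcal{O})$ with $\mathcal{O}=[C^{\mathsf T}\ (CA)^{\mathsf T}\ \cdots\ (CA^{n-1})^{\mathsf T}]^{\mathsf T}$. For subspaces $U,V\subseteq\mathbb{R}^r$, $U\perp V$ means every vector of $U$ is orthogonal to every vector of $V$. *)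

theory Defs
  imports "HOL-Analysis.Analysis"
begin

text \<open>The library multiplication on \<open>real^'n^'n\<close> is entrywise, so neither \<open>^\<close> nor \<open>exp\<close> gives
  the matrix notion.\<close>

definition mat_pow :: "real^'n^'n \<Rightarrow> nat \<Rightarrow> real^'n^'n" where
  "mat_pow A k = (((**) A) ^^ k) (mat 1)"

definition mat_exp :: "real^'n^'n \<Rightarrow> real^'n^'n" where
  "mat_exp A = (\<Sum>k. (1 / fact k) *\<^sub>R mat_pow A k)"

definition mat_ker :: "real^'n^'m \<Rightarrow> (real^'n) set" where
  "mat_ker M = {x. M *v x = 0}"

definition mat_im :: "real^'n^'m \<Rightarrow> (real^'m) set" where
  "mat_im M = range ((*v) M)"

definition perp :: "(real^'n) set \<Rightarrow> (real^'n) set \<Rightarrow> bool" where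
  "perp U V \<longleftrightarrow> (\<forall>u\<in>U. \<forall>v\<in>V. orthogonal u v)"

definition obs_gramian :: "real \<Rightarrow> real^'n^'q \<Rightarrow> real^'n^'n \<Rightarrow> real^'n^'n" where
  "obs_gramian t1 C A =
     integral {0..t1} (\<lambda>\<tau>. mat_exp (\<tau> *\<^sub>R transpose A) ** transpose C ** C ** mat_exp (\<tau> *\<^sub>R A))"

definition functionally_observable_set ::
    "real \<Rightarrow> real^'n^'q \<Rightarrow> real^'n^'n \<Rightarrow> real^'n^'r \<Rightarrow> (real^'r) set" where
  "functionally_observable_set t1 C A F =
     {z. (\<forall>w \<in> (*v) F ` mat_ker (obs_gramian t1 C A). orthogonal z w) \<and>
         z \<in> (*v) F ` mat_im (obs_gramian t1 C A)}"

definition functionally_observable ::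
    "real \<Rightarrow> real^'n^'q \<Rightarrow> real^'n^'n \<Rightarrow> real^'n^'r \<Rightarrow> bool" where
  "functionally_observable t1 C A F \<longleftrightarrow> functionally_observable_set t1 C A F = UNIV"

text \<open>\<open>x\<close> solves \<open>x' = A x + B u\<close>, \<open>x 0 = x0\<close> on \<open>[0, t1]\<close>. Inputs are arbitrary integrable functions,
  so the equation is read in integrated (Caratheodory) form; for continuous \<open>u\<close> this is the
  classical notion of solution.\<close>

definition lti_trajectory ::
    "real \<Rightarrow> real^'n^'n \<Rightarrow> real^'m^'n \<Rightarrow> real^'n \<Rightarrow> (real \<Rightarrow> real^'m) \<Rightarrow> (real \<Rightarrow> real^'n) \<Rightarrow> bool" where
  "lti_trajectory t1 A B x0 u x \<longleftrightarrow>
     u absolutely_integrable_on {0..t1} \<and>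
     continuous_on {0..t1} x \<and>
     (\<forall>t\<in>{0..t1}. ((\<lambda>s. A *v x s + B *v u s) has_integral (x t - x0)) {0..t})"

definition output_controllable_set ::
    "real \<Rightarrow> real^'n^'n \<Rightarrow> real^'m^'n \<Rightarrow> real^'n^'r \<Rightarrow> (real^'r) set" where
  "output_controllable_set t1 A B F = {z. \<exists>u x. lti_trajectory t1 A B 0 u x \<and> F *v x t1 = z}"

definition output_controllable ::
    "real \<Rightarrow> real^'n^'n \<Rightarrow> real^'m^'n \<Rightarrow> real^'n^'r \<Rightarrow> bool" where
  "output_controllable t1 A B F \<longleftrightarrow> output_controllable_set t1 A B F = UNIV"

end

theory Submission
  imports Defs
begin

text \<open>The point is that the states reachable by the dual system are exactly the range of the
  Gramian \<open>W\<close>; both claims then follow by unfolding the definitions. The control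
  \<open>u s = C e\<^bsup>(t1 - s)A\<^esup> p\<close> reaches \<open>W p\<close>. Conversely, \<open>W\<close> is symmetric, so it suffices that a reachable
  state is orthogonal to every \<open>v\<close> with \<open>W v = 0\<close>; such a \<open>v\<close> satisfies \<open>C A\<^sup>k v = 0\<close> for all \<open>k\<close>,
  so the functions \<open>g\<^sub>k t = A\<^sup>k v \<bullet> x t\<close> do not see the input.\<close>

subsection \<open>The matrix exponential\<close>

text \<open>Bilinear maps on finite-dimensional spaces are bounded. This one fact later supplies
  continuity, product rules, termwise multiplication of series and norm constants.\<close>

lemma bounded_bilinear_matrix_mult:
  "bounded_bilinear ((**) :: real^'n^'m \<Rightarrow> real^'p^'n \<Rightarrow> real^'p^'m)"
  unfolding bilinear_conv_bounded_bilinear[symmetric] bilinear_def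
  by (auto intro!: linearI simp: matrix_add_ldistrib vec_eq_iff matrix_matrix_mult_def
      sum.distrib sum_distrib_left algebra_simps)

lemma bounded_bilinear_matrix_vector_mult:
  "bounded_bilinear ((*v) :: real^'n^'m \<Rightarrow> real^'n \<Rightarrow> real^'m)"
  unfolding bilinear_conv_bounded_bilinear[symmetric] bilinear_def
  by (auto intro!: linearI simp: vec_eq_iff matrix_vector_mult_def
      sum.distrib sum_distrib_left algebra_simps)

lemmas continuous_on_matrix_mult [continuous_intros] =
  bounded_bilinear.continuous_on[OF bounded_bilinear_matrix_mult]
lemmas continuous_on_matrix_vector_mult [continuous_intros] =
  bounded_bilinear.continuous_on[OF bounded_bilinear_matrix_vector_mult]
lemmas matrix_mult_scaleR_left =
  bounded_bilinear.scaleR_left[OF bounded_bilinear_matrix_mult]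
lemmas matrix_mult_scaleR_right =
  bounded_bilinear.scaleR_right[OF bounded_bilinear_matrix_mult]

lemma bounded_linear_transpose: "bounded_linear (transpose :: real^'n^'m \<Rightarrow> real^'m^'n)"
  by (intro linear_conv_bounded_linear[THEN iffD1] linearI) (auto simp: vec_eq_iff transpose_def)

lemma mat_pow_0 [simp]: "mat_pow A 0 = mat 1"
  and mat_pow_Suc: "mat_pow A (Suc k) = A ** mat_pow A k"
  by (simp_all add: mat_pow_def)

lemma mat_pow_commute: "A ** mat_pow A k = mat_pow A k ** A"
proof (induction k)
  case (Suc k)
  then show ?case by (metis mat_pow_Suc matrix_mul_assoc)
qed simp

lemma mat_pow_scaleR: "mat_pow (t *\<^sub>R A) k = t ^ k *\<^sub>R mat_pow A k"
  by (induction k) (simp_all add: mat_pow_Suc matrix_mult_scaleR_left matrix_mult_scaleR_right)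

lemma transpose_mat_pow: "transpose (mat_pow A k) = mat_pow (transpose A) k"
  by (induction k) (simp_all add: mat_pow_Suc matrix_transpose_mul mat_pow_commute)

text \<open>The norm here is the Euclidean one on entries, so the product estimate is taken from
  boundedness with a constant \<open>K\<close>. The geometric bound serves both the exponential
  series and the iterated integrals along a trajectory.\<close>

lemma norm_mat_pow_bound:
  fixes A :: "real^'n^'n"
  obtains L M where "L > 0" "M > 0" "\<And>k. norm (mat_pow A k) \<le> M * L ^ k"
proof -
  obtain K where K: "K > 0" "\<And>(X :: real^'n^'n) (Y :: real^'n^'n). norm (X ** Y) \<le> norm X * norm Y * K"
    using bounded_bilinear.pos_bounded[OF bounded_bilinear_matrix_mult] by blast
  \<comment> \<open>The summand 1 keeps \<open>L\<close> positive even when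
    \<open>A = 0\<close>.\<close>
  define L where "L = norm A * K + 1"
  define M where "M = norm (mat 1 :: real^'n^'n) + 1"
  have L: "L > 0" "norm A * K \<le> L" and M: "M > 0"
    using K(1) by (auto simp: L_def M_def add_nonneg_pos)
  have "norm (mat_pow A k) \<le> M * L ^ k" for k
  proof (induction k)
    case 0
    show ?case by (simp add: M_def)
  next
    case (Suc k)
    have "norm (mat_pow A (Suc k)) \<le> (norm A * K) * norm (mat_pow A k)"
      using K(2)[of A "mat_pow A k"] by (simp add: mat_pow_Suc mult_ac)
    also have "\<dots> \<le> L * (M * L ^ k)"
      using L Suc by (intro mult_mono) auto
    finally show ?case by (simp add: mult_ac)
  qed
  with L(1) M show ?thesis using that by blast
qed

lemma summable_mat_exp:
  fixes A :: "real^'n^'n"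
  shows "summable (\<lambda>k. (1 / fact k) *\<^sub>R mat_pow A k)"
proof -
  obtain L M where LM: "L > 0" "M > 0" "\<And>k. norm (mat_pow A k) \<le> M * L ^ k"
    by (rule norm_mat_pow_bound[of A]) blast
  have "summable (\<lambda>k. M * (L ^ k /\<^sub>R fact k))"
    by (intro summable_mult summable_exp_generic)
  then show ?thesis
  proof (rule summable_comparison_test[rotated], intro exI allI impI)
    show "norm ((1 / fact k) *\<^sub>R mat_pow A k) \<le> M * (L ^ k /\<^sub>R fact k)" for k
      using LM(3)[of k] by (simp add: field_simps)
  qed
qed

lemma mat_exp_sums: "(\<lambda>k. (1 / fact k) *\<^sub>R mat_pow A k) sums mat_exp A"
  using summable_mat_exp unfolding mat_exp_def by (rule summable_sums)

lemma mat_exp_0 [simp]: "mat_exp 0 = mat 1"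
proof -
  \<comment> \<open>Writing the zero matrix as \<open>0 *\<^sub>R 0\<close> turns its power into a
    multiple of \<open>0 ^ k\<close>.\<close>
  have "(1 / fact k) *\<^sub>R mat_pow (0 :: real^'n^'n) k = 0" if "k \<noteq> 0" for k
    using mat_pow_scaleR[of 0 "0 :: real^'n^'n" k] that by (simp add: power_0_left)
  then have "(\<lambda>k. (1 / fact k) *\<^sub>R mat_pow (0 :: real^'n^'n) k) sums (\<Sum>k\<in>{0}. (1 / fact k) *\<^sub>R mat_pow 0 k)"
    by (intro sums_finite) auto
  then show ?thesis
    using mat_exp_sums sums_unique2 by fastforce
qed

lemma mat_exp_commute: "A ** mat_exp (t *\<^sub>R A) = mat_exp (t *\<^sub>R A) ** A"
proof -
  let ?T = "\<lambda>k. (1 / fact k) *\<^sub>R mat_pow (t *\<^sub>R A) k"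
  have "(\<lambda>k. A ** ?T k) sums (A ** mat_exp (t *\<^sub>R A))"
    by (intro bounded_linear.sums[OF bounded_bilinear.bounded_linear_right[OF bounded_bilinear_matrix_mult]] mat_exp_sums)
  moreover have "(\<lambda>k. ?T k ** A) sums (mat_exp (t *\<^sub>R A) ** A)"
    by (intro bounded_linear.sums[OF bounded_bilinear.bounded_linear_left[OF bounded_bilinear_matrix_mult]] mat_exp_sums)
  moreover have "A ** ?T k = ?T k ** A" for k
    by (simp add: mat_pow_scaleR matrix_mult_scaleR_left matrix_mult_scaleR_right mat_pow_commute)
  ultimately show ?thesis
    using sums_unique2 by simp
qed

lemma transpose_mat_exp: "transpose (mat_exp A) = mat_exp (transpose A)"
proof -
  have "(\<lambda>k. transpose ((1 / fact k) *\<^sub>R mat_pow A k)) sums transpose (mat_exp A)"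
    by (intro bounded_linear.sums[OF bounded_linear_transpose] mat_exp_sums)
  then show ?thesis
    using mat_exp_sums[of "transpose A"]
    by (simp add: transpose_scalar transpose_mat_pow sums_unique2)
qed

text \<open>Each entry of the exponential is an everywhere convergent real power series in
  \<open>t\<close>, so the scalar theorem on termwise differentiation applies entry by
  entry.\<close>

lemma mat_exp_has_vector_derivative:
  fixes A :: "real^'n^'n"
  shows
  "((\<lambda>t. mat_exp (t *\<^sub>R A)) has_vector_derivative A ** mat_exp (t *\<^sub>R A)) (at t within S)"
proof -
  have "((\<lambda>t. mat_exp (t *\<^sub>R A) \<bullet> b) has_derivative (\<lambda>h. (h *\<^sub>R (A ** mat_exp (t *\<^sub>R A))) \<bullet> b)) (at t)"
    if "b \<in> Basis" for b
  proof -
    define c where "c k = (1 / fact k) * (mat_pow A k \<bullet> b)" for k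
    have E: "(\<lambda>k. c k * s ^ k) sums (mat_exp (s *\<^sub>R A) \<bullet> b)" for s
      using bounded_linear.sums[OF bounded_linear_inner_left mat_exp_sums, of "s *\<^sub>R A" b]
      by (simp add: c_def mat_pow_scaleR mult_ac)
    \<comment> \<open>The formally differentiated series is the exponential series multiplied by
      \<open>A\<close>: the factor \<open>Suc k\<close> cancels against the factorial.\<close>
    have D: "(\<lambda>k. diffs c k * t ^ k) sums ((A ** mat_exp (t *\<^sub>R A)) \<bullet> b)"
    proof -
      have "(\<lambda>k. (A ** ((1 / fact k) *\<^sub>R mat_pow (t *\<^sub>R A) k)) \<bullet> b) sums ((A ** mat_exp (t *\<^sub>R A)) \<bullet> b)"
        by (intro bounded_linear.sums[OF bounded_linear_inner_left]
            bounded_linear.sums[OF bounded_bilinear.bounded_linear_right[OF bounded_bilinear_matrix_mult]]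
            mat_exp_sums)
      moreover have "(A ** ((1 / fact k) *\<^sub>R mat_pow (t *\<^sub>R A) k)) \<bullet> b = diffs c k * t ^ k" for k
      proof -
        have "diffs c k = (1 / fact k) * (mat_pow A (Suc k) \<bullet> b)"
          by (simp add: diffs_def c_def divide_simps del: of_nat_Suc)
        then show ?thesis
          by (simp add: mat_pow_scaleR matrix_mult_scaleR_right mat_pow_Suc)
      qed
      ultimately show ?thesis by simp
    qed
    have "((\<lambda>s. \<Sum>k. c k * s ^ k) has_field_derivative (\<Sum>k. diffs c k * t ^ k)) (at t)"
      using E by (intro termdiffs_strong_converges_everywhere) (rule sums_summable)
    then have "((\<lambda>s. mat_exp (s *\<^sub>R A) \<bullet> b) has_field_derivative (A ** mat_exp (t *\<^sub>R A)) \<bullet> b) (at t)"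
      using E D by (simp add: sums_iff)
    then show ?thesis
      by (simp add: has_field_derivative_def mult_commute_abs)
  qed
  then have "((\<lambda>t. mat_exp (t *\<^sub>R A)) has_vector_derivative A ** mat_exp (t *\<^sub>R A)) (at t)"
    unfolding has_vector_derivative_def by (subst has_derivative_componentwise_within) blast
  then show ?thesis
    by (rule has_vector_derivative_at_within)
qed

lemma mat_exp_affine_has_vector_derivative:
  "((\<lambda>t. mat_exp ((c * t + d) *\<^sub>R A)) has_vector_derivative
     c *\<^sub>R (A ** mat_exp ((c * t + d) *\<^sub>R A))) (at t within S)"
proof -
  have "((\<lambda>t. c * t + d) has_vector_derivative c) (at t within S)"
    by (auto intro!: derivative_eq_intros simp: has_real_derivative_iff_has_vector_derivative[symmetric])
  from vector_diff_chain_within[OF this mat_exp_has_vector_derivative] show ?thesis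
    by (simp add: o_def)
qed

lemma continuous_on_mat_exp [continuous_intros]:
  assumes "continuous_on S f"
  shows "continuous_on S (\<lambda>x. mat_exp (f x *\<^sub>R A))"
proof (rule continuous_on_compose2[OF _ assms subset_UNIV])
  show "continuous_on UNIV (\<lambda>t. mat_exp (t *\<^sub>R A))"
    by (rule continuous_on_vector_derivative) (rule mat_exp_has_vector_derivative)
qed

text \<open>The product \<open>?g\<close> has zero derivative, since \<open>A\<close> commutes with
  its exponentials. Its values at \<open>- s\<close> and \<open>0\<close> are the two sides.\<close>

lemma mat_exp_add: "mat_exp ((s + t) *\<^sub>R A) = mat_exp (s *\<^sub>R A) ** mat_exp (t *\<^sub>R A)"
proof -
  let ?g = "\<lambda>r. mat_exp ((- r) *\<^sub>R A) ** mat_exp ((s + t + r) *\<^sub>R A)"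
  have "(?g has_vector_derivative 0) (at r within UNIV)" for r
  proof -
    have "(?g has_vector_derivative
        mat_exp ((- r) *\<^sub>R A) ** (A ** mat_exp ((s + t + r) *\<^sub>R A))
        + (- (A ** mat_exp ((- r) *\<^sub>R A))) ** mat_exp ((s + t + r) *\<^sub>R A)) (at r within UNIV)"
      using bounded_bilinear.has_vector_derivative[OF bounded_bilinear_matrix_mult
          mat_exp_affine_has_vector_derivative[of "-1" 0 A r UNIV]
          mat_exp_affine_has_vector_derivative[of 1 "s + t" A r UNIV]]
      by (simp add: add.commute add.left_commute)
    moreover have "mat_exp ((- r) *\<^sub>R A) ** (A ** mat_exp ((s + t + r) *\<^sub>R A))
        = (A ** mat_exp ((- r) *\<^sub>R A)) ** mat_exp ((s + t + r) *\<^sub>R A)"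
      by (metis matrix_mul_assoc mat_exp_commute)
    ultimately show ?thesis
      by (simp only: bounded_bilinear.minus_left[OF bounded_bilinear_matrix_mult] right_minus)
  qed
  then have "?g (-s) = ?g 0"
    using has_derivative_zero_unique[of UNIV ?g "- s" 0]
    by (simp add: has_vector_derivative_def)
  then show ?thesis
    by simp
qed


subsection \<open>The observability Gramian\<close>

lemma inner_transpose_mult: "(transpose M *v x) \<bullet> y = x \<bullet> (M *v y)" for M :: "real^'n^'m"
  by (simp add: dot_lmul_matrix)

context
  fixes A :: "real^'n^'n" and C :: "real^'n^'q" and t1 :: real
begin

definition gram_density :: "real \<Rightarrow> real^'n^'n" where
  "gram_density \<tau> = mat_exp (\<tau> *\<^sub>R transpose A) ** transpose C ** C ** mat_exp (\<tau> *\<^sub>R A)"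

lemma continuous_on_gram_density: "continuous_on S gram_density"
  unfolding gram_density_def by (intro continuous_intros)

lemma has_integral_obs_gramian:
  "((\<lambda>\<tau>. gram_density \<tau> *v p) has_integral (obs_gramian t1 C A *v p)) {0..t1}"
proof -
  have "(gram_density has_integral obs_gramian t1 C A) {0..t1}"
    unfolding obs_gramian_def gram_density_def[symmetric]
    by (intro integrable_integral integrable_continuous_real continuous_on_gram_density)
  from has_integral_linear[OF this bounded_bilinear.bounded_linear_left[OF bounded_bilinear_matrix_vector_mult]]
  show ?thesis by (simp add: o_def)
qed

lemma inner_gram_density:
  "(gram_density \<tau> *v p) \<bullet> q = (C *v (mat_exp (\<tau> *\<^sub>R A) *v p)) \<bullet> (C *v (mat_exp (\<tau> *\<^sub>R A) *v q))"
proof -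
  have "gram_density \<tau> *v p
      = transpose (mat_exp (\<tau> *\<^sub>R A)) *v (transpose C *v (C *v (mat_exp (\<tau> *\<^sub>R A) *v p)))"
    by (simp only: gram_density_def transpose_mat_exp transpose_scalar
          matrix_vector_mul_assoc matrix_mul_assoc)
  then show ?thesis
    by (simp only: inner_transpose_mult)
qed

text \<open>The Gramian's bilinear form is the L2 inner product of the outputs started at
  \<open>p\<close> and \<open>q\<close>; symmetry and the description of the kernel both come from
  this.\<close>

lemma has_integral_inner_obs_gramian:
  "((\<lambda>\<tau>. (C *v (mat_exp (\<tau> *\<^sub>R A) *v p)) \<bullet> (C *v (mat_exp (\<tau> *\<^sub>R A) *v q)))
     has_integral ((obs_gramian t1 C A *v p) \<bullet> q)) {0..t1}"
  using has_integral_linear[OF has_integral_obs_gramian[of p] bounded_linear_inner_left[of q]]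
  by (simp add: o_def inner_gram_density)

lemma obs_gramian_self_adjoint:
  "(obs_gramian t1 C A *v p) \<bullet> q = p \<bullet> (obs_gramian t1 C A *v q)"
proof (rule has_integral_unique[OF has_integral_inner_obs_gramian])
  show "((\<lambda>\<tau>. (C *v (mat_exp (\<tau> *\<^sub>R A) *v p)) \<bullet> (C *v (mat_exp (\<tau> *\<^sub>R A) *v q)))
     has_integral (p \<bullet> (obs_gramian t1 C A *v q))) {0..t1}"
    using has_integral_inner_obs_gramian[of q p] by (simp only: inner_commute)
qed

text \<open>The output energy from \<open>v\<close> is the integral of a continuous nonnegative
  function and equals \<open>(W v) \<bullet> v = 0\<close>, so the output vanishes
  pointwise.\<close>

lemma obs_gramian_ker_output:
  assumes "obs_gramian t1 C A *v v = 0" "t1 > 0" "\<tau> \<in> {0..t1}"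
  shows "C *v (mat_exp (\<tau> *\<^sub>R A) *v v) = 0"
proof -
  let ?h = "\<lambda>\<tau>. (C *v (mat_exp (\<tau> *\<^sub>R A) *v v)) \<bullet> (C *v (mat_exp (\<tau> *\<^sub>R A) *v v))"
  have "continuous_on {0..t1} (\<lambda>\<tau>. C *v (mat_exp (\<tau> *\<^sub>R A) *v v))"
    by (intro continuous_intros)
  then have "continuous_on (cbox 0 t1) ?h"
    by (simp add: continuous_on_inner)
  moreover have "(?h has_integral 0) (cbox 0 t1)"
    using has_integral_inner_obs_gramian[of v v] assms(1) by simp
  ultimately have "?h \<tau> = 0"
    using assms by (intro has_integral_0_cbox_imp_0[of 0 t1 ?h]) auto
  then show ?thesis by simp
qed

text \<open>Differentiating the vanishing output \<open>k\<close> times and setting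
  \<open>\<tau> = 0\<close> gives the claim. The induction covers the whole interval, because a
  value at 0 alone could not be differentiated.\<close>

lemma obs_gramian_ker_unobservable:
  assumes ker: "obs_gramian t1 C A *v v = 0" and t1: "t1 > 0"
  shows "C *v (mat_pow A k *v v) = 0"
proof -
  have "C *v (mat_pow A k *v (mat_exp (\<tau> *\<^sub>R A) *v v)) = 0" if "\<tau> \<in> {0..t1}" for \<tau>
    using that
  proof (induction k arbitrary: \<tau>)
    case 0
    then show ?case using obs_gramian_ker_output[OF ker t1] by simp
  next
    case (Suc k)
    let ?L = "\<lambda>X. C *v (mat_pow A k *v (X *v v))"
    have lin: "bounded_linear ?L"
      by (intro bounded_linear_compose[OF matrix_vector_mul_bounded_linear]
          bounded_bilinear.bounded_linear_left[OF bounded_bilinear_matrix_vector_mult])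
    have "((\<lambda>s. ?L (mat_exp (s *\<^sub>R A))) has_vector_derivative ?L (A ** mat_exp (\<tau> *\<^sub>R A)))
        (at \<tau> within {0..t1})"
      by (intro bounded_linear.has_vector_derivative[OF lin] mat_exp_has_vector_derivative)
    moreover have "((\<lambda>s. ?L (mat_exp (s *\<^sub>R A))) has_vector_derivative 0) (at \<tau> within {0..t1})"
      by (rule has_vector_derivative_transform[where f = "\<lambda>_. 0"])
        (use Suc in \<open>simp_all add: has_vector_derivative_const\<close>)
    \<comment> \<open>Derivatives within the interval are unique, also at its end points, because
      \<open>t1 > 0\<close>.\<close>
    ultimately have "?L (A ** mat_exp (\<tau> *\<^sub>R A)) = 0"
      using vector_derivative_unique_within_closed_interval[of 0 t1 \<tau>, unfolded box_real] t1 Suc.prems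
      by blast
    then show ?case
      by (simp add: mat_pow_Suc mat_pow_commute flip: matrix_vector_mul_assoc)
  qed
  from this[of 0] show ?thesis using t1 by simp
qed

end

text \<open>Split \<open>y\<close> into a part \<open>a\<close> in the range and a part
  \<open>b\<close> orthogonal to it. Self-adjointness puts \<open>b\<close> in the kernel, so
  \<open>y \<bullet> b = 0\<close>, which forces \<open>b = 0\<close>.\<close>

lemma perp_ker_imp_mem_im:
  fixes W :: "real^'n^'n"
  assumes self_adjoint: "\<And>p q. (W *v p) \<bullet> q = p \<bullet> (W *v q)"
    and perp: "\<And>v. W *v v = 0 \<Longrightarrow> y \<bullet> v = 0"
  shows "y \<in> mat_im W"
proof -
  have "subspace (mat_im W)"
    unfolding mat_im_def by (intro linear_subspace_image subspace_UNIV matrix_vector_mul_linear)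
  then obtain a b where a: "a \<in> mat_im W" and b: "\<And>w. w \<in> mat_im W \<Longrightarrow> orthogonal b w"
    and y: "y = a + b"
    using orthogonal_subspace_decomp_exists[of "mat_im W" y] by (metis span_eq_iff)
  have "(W *v b) \<bullet> (W *v b) = b \<bullet> (W *v (W *v b))"
    by (rule self_adjoint)
  also have "\<dots> = 0"
    using b by (simp add: mat_im_def orthogonal_def)
  finally have "y \<bullet> b = 0"
    using perp by simp
  moreover have "a \<bullet> b = 0"
    using b[OF a] by (simp add: orthogonal_def inner_commute)
  ultimately show ?thesis
    using a y by (simp add: inner_add_left)
qed

subsection \<open>Reachable states of the dual system\<close>

lemma lti_trajectory_perp_unobservable:
  fixes A :: "real^'n^'n" and C :: "real^'n^'q"
  assumes traj: "lti_trajectory t1 (transpose A) (transpose C) 0 u x"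
    and unobs: "\<And>k. C *v (mat_pow A k *v v) = 0"
    and t: "t \<in> {0..t1}"
  shows "v \<bullet> x t = 0"
proof -
  \<comment> \<open>Each \<open>g k\<close> is the primitive of \<open>g (Suc k)\<close> vanishing at 0, and all are bounded by \<open>B L\<^sup>k\<close>;
    iterating the integral gives the bound \<open>B (L t)\<^sup>m / m!\<close> on \<open>g 0 t\<close> for every \<open>m\<close>.\<close>
  define g where "g k t = (mat_pow A k *v v) \<bullet> x t" for k t
  have int: "(g (Suc k) has_integral g k t) {0..t}" if "t \<in> {0..t1}" for k t
  proof -
    have "((\<lambda>s. transpose A *v x s + transpose C *v u s) has_integral x t) {0..t}"
      using traj that by (simp add: lti_trajectory_def)
    from has_integral_linear[OF this bounded_linear_inner_right[of "mat_pow A k *v v"]]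
    \<comment> \<open>Moving the transposes across the inner product turns the drift term into
      \<open>g (Suc k)\<close> and the input term into
      \<open>(C *v (mat_pow A k *v v)) \<bullet> u s\<close>, which is zero by
      \<open>unobs\<close>.\<close>
    show ?thesis
      by (simp add: o_def g_def[abs_def] inner_add_right inner_commute[of _ "_ v* _"] dot_lmul_matrix unobs
          mat_pow_Suc inner_commute[of "x _"] flip: matrix_vector_mul_assoc)
  qed
  obtain L M where L: "L > 0" and M: "M > 0" and LM: "\<And>k. norm (mat_pow A k) \<le> M * L ^ k"
    by (rule norm_mat_pow_bound[of A]) blast
  obtain K where K: "K > 0" "\<And>(X :: real^'n^'n) w. norm (X *v w) \<le> norm X * norm w * K"
    using bounded_bilinear.pos_bounded[OF bounded_bilinear_matrix_vector_mult] by blast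
  have "compact (x ` {0..t1})"
    using traj by (intro compact_continuous_image) (auto simp: lti_trajectory_def)
  then obtain X where X: "\<And>s. s \<in> {0..t1} \<Longrightarrow> norm (x s) \<le> X"
    by (meson compact_imp_bounded bounded_iff imageI)
  define B where "B = M * norm v * K * X"
  have base: "\<bar>g k s\<bar> \<le> B * L ^ k" if "s \<in> {0..t1}" for k s
  proof -
    have "\<bar>g k s\<bar> \<le> norm (mat_pow A k *v v) * norm (x s)"
      unfolding g_def by (rule Cauchy_Schwarz_ineq2)
    also have "\<dots> \<le> ((M * L ^ k) * norm v * K) * X"
    proof (intro mult_mono X that)
      show "norm (mat_pow A k *v v) \<le> M * L ^ k * norm v * K"
        using K(1) by (intro order_trans[OF K(2)] mult_right_mono LM) auto
      show "0 \<le> M * L ^ k * norm v * K"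
        using K(1) L M by simp
    qed simp
    finally show ?thesis by (simp add: B_def mult_ac)
  qed
  \<comment> \<open>\<open>k\<close> must stay arbitrary: each integration uses the hypothesis at
    \<open>Suc k\<close>, and \<open>Suc k + m = k + Suc m\<close> gives the exponent.\<close>
  have bound: "\<bar>g k s\<bar> \<le> B * L ^ (k + m) * s ^ m / fact m" if "s \<in> {0..t1}" for k m s
    using that
  proof (induction m arbitrary: k s)
    case 0
    then show ?case using base by simp
  next
    case (Suc m)
    let ?h = "\<lambda>r. B * L ^ (k + Suc m) * r ^ m / fact m"
    let ?H = "\<lambda>r. B * L ^ (k + Suc m) * r ^ Suc m / fact (Suc m)"
    have "(?H has_vector_derivative ?h r) (at r within {0..s})" for r
      using DERIV_cdivide[OF DERIV_cmult[OF DERIV_pow[of "Suc m"]], of "B * L ^ (k + Suc m)" "fact (Suc m)"]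
      by (simp add: has_real_derivative_iff_has_vector_derivative mult_ac del: of_nat_Suc power_Suc)
    then have "(?h has_integral (?H s - ?H 0)) {0..s}"
      using Suc.prems by (intro fundamental_theorem_of_calculus) auto
    then have H: "(?h has_integral ?H s) {0..s}"
      by simp
    \<comment> \<open>The inner product with 1, the basis vector of the reals, fits the
      componentwise form of the integral bound.\<close>
    have "norm (g (Suc k) r) \<le> ?h r \<bullet> 1" if "r \<in> {0..s}" for r
      using Suc.IH[of r "Suc k"] Suc.prems that by simp
    from has_integral_norm_bound_integral_component[OF int[OF Suc.prems] H this]
    show ?case by simp
  qed
  \<comment> \<open>These are the terms of a convergent exponential series, scaled by
    \<open>B\<close>.\<close>
  have "(\<lambda>m. B * ((L * t) ^ m /\<^sub>R fact m)) \<longlonglongrightarrow> B * 0"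
    by (intro tendsto_mult tendsto_const summable_LIMSEQ_zero summable_exp_generic)
  moreover have "\<forall>m\<ge>0. \<bar>g 0 t\<bar> \<le> B * ((L * t) ^ m /\<^sub>R fact m)"
    using bound[OF t, of 0] by (simp add: power_mult_distrib field_simps)
  ultimately have "\<bar>g 0 t\<bar> \<le> 0"
    by (intro LIMSEQ_le_const) auto
  then show ?thesis by (simp add: g_def)
qed

text \<open>Variation of constants. With \<open>mat_exp (t *\<^sub>R A)\<close> outside the
  integral, the product rule suffices to differentiate \<open>x\<close>; continuity of
  \<open>u\<close> makes the integral differentiable.\<close>

lemma lti_trajectory_exists:
  fixes A :: "real^'n^'n" and B :: "real^'m^'n"
  assumes u: "continuous_on {0..t1} u" and t1: "t1 \<ge> 0"
  defines "x \<equiv> \<lambda>t. mat_exp (t *\<^sub>R A) *v integral {0..t} (\<lambda>s. mat_exp ((- s) *\<^sub>R A) *v (B *v u s))"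
  shows "lti_trajectory t1 A B 0 u x"
    and "x t1 = integral {0..t1} (\<lambda>s. mat_exp ((t1 - s) *\<^sub>R A) *v (B *v u s))"
proof -
  let ?f = "\<lambda>s. mat_exp ((- s) *\<^sub>R A) *v (B *v u s)"
  have f: "continuous_on {0..t1} ?f"
    by (intro continuous_intros u)
  have inv: "mat_exp (t *\<^sub>R A) *v (mat_exp ((- s) *\<^sub>R A) *v w) = mat_exp ((t - s) *\<^sub>R A) *v w" for t s w
    using mat_exp_add[of t "- s" A] by (simp add: matrix_vector_mul_assoc)
  have deriv: "(x has_vector_derivative A *v x t + B *v u t) (at t within {0..t1})"
    if "t \<in> {0..t1}" for t
  proof -
    have "(x has_vector_derivative mat_exp (t *\<^sub>R A) *v ?f t
        + (A ** mat_exp (t *\<^sub>R A)) *v integral {0..t} ?f) (at t within {0..t1})"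
      unfolding x_def
      by (intro bounded_bilinear.has_vector_derivative[OF bounded_bilinear_matrix_vector_mult]
          mat_exp_has_vector_derivative integral_has_vector_derivative f that)
    then show ?thesis
      by (simp only: inv) (simp add: x_def matrix_vector_mul_assoc add.commute)
  qed
  have "((\<lambda>s. A *v x s + B *v u s) has_integral (x t - 0)) {0..t}" if "t \<in> {0..t1}" for t
  proof -
    have "((\<lambda>s. A *v x s + B *v u s) has_integral (x t - x 0)) {0..t}"
      using that by (intro fundamental_theorem_of_calculus)
        (auto intro!: has_vector_derivative_within_subset[OF deriv])
    then show ?thesis by (simp add: x_def)
  qed
  moreover have "continuous_on {0..t1} x"
    by (rule continuous_on_vector_derivative[OF deriv])
  ultimately show "lti_trajectory t1 A B 0 u x"
    using u by (simp add: lti_trajectory_def absolutely_integrable_continuous_real)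
  have "?f integrable_on {0..t1}"
    by (rule integrable_continuous_real[OF f])
  from integral_linear[OF this matrix_vector_mul_bounded_linear[of "mat_exp (t1 *\<^sub>R A)"]]
  show "x t1 = integral {0..t1} (\<lambda>s. mat_exp ((t1 - s) *\<^sub>R A) *v (B *v u s))"
    by (simp only: o_def inv x_def)
qed

lemma obs_gramian_reachable:
  fixes A :: "real^'n^'n" and C :: "real^'n^'q"
  assumes t1: "t1 > 0"
  obtains u x where "lti_trajectory t1 (transpose A) (transpose C) 0 u x" "x t1 = obs_gramian t1 C A *v p"
proof -
  define u where "u s = C *v (mat_exp ((t1 - s) *\<^sub>R A) *v p)" for s
  have "continuous_on {0..t1} u"
    unfolding u_def by (intro continuous_intros)
  note traj = lti_trajectory_exists[OF this less_imp_le[OF t1], of "transpose A" "transpose C"]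
  have "((\<lambda>s. gram_density A C (t1 - s) *v p) has_integral obs_gramian t1 C A *v p) {0..t1}"
  proof -
    \<comment> \<open>Reflection followed by a shift by \<open>t1\<close> performs the substitution
      \<open>\<tau> = t1 - s\<close>.\<close>
    have "((\<lambda>s. gram_density A C (- s) *v p) has_integral obs_gramian t1 C A *v p) {- t1..- 0}"
      using has_integral_obs_gramian by (subst has_integral_reflect_real)
    from has_integral_shift_real_ivl[OF this, of "- t1"] show ?thesis
      by simp
  qed
  moreover have "gram_density A C (t1 - s) *v p
      = mat_exp ((t1 - s) *\<^sub>R transpose A) *v (transpose C *v u s)" for s
    by (simp only: gram_density_def u_def matrix_vector_mul_assoc matrix_mul_assoc)
  ultimately show ?thesis
    using traj that by (metis (no_types, lifting) ext integral_unique)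
qed

lemma output_controllable_set_eq_image_obs_gramian:
  fixes A :: "real^'n^'n" and C :: "real^'n^'q" and F :: "real^'n^'r"
  assumes t1: "t1 > 0"
  shows "output_controllable_set t1 (transpose A) (transpose C) F = (*v) F ` mat_im (obs_gramian t1 C A)"
proof (intro equalityI subsetI)
  fix z assume "z \<in> output_controllable_set t1 (transpose A) (transpose C) F"
  then obtain u x where traj: "lti_trajectory t1 (transpose A) (transpose C) 0 u x" and z: "z = F *v x t1"
    by (auto simp: output_controllable_set_def)
  \<comment> \<open>This holds for any admissible integrable input, not only for the continuous
    controls used in the converse inclusion.\<close>
  have "x t1 \<bullet> v = 0" if "obs_gramian t1 C A *v v = 0" for v
    using lti_trajectory_perp_unobservable[OF traj obs_gramian_ker_unobservable[OF that t1], of t1] t1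
    by (simp add: inner_commute)
  then have "x t1 \<in> mat_im (obs_gramian t1 C A)"
    by (intro perp_ker_imp_mem_im obs_gramian_self_adjoint)
  then show "z \<in> (*v) F ` mat_im (obs_gramian t1 C A)"
    using z by blast
next
  fix z assume "z \<in> (*v) F ` mat_im (obs_gramian t1 C A)"
  then obtain p where "z = F *v (obs_gramian t1 C A *v p)"
    by (auto simp: mat_im_def)
  then show "z \<in> output_controllable_set t1 (transpose A) (transpose C) F"
    using obs_gramian_reachable[OF t1, of A C p] by (auto simp: output_controllable_set_def) metis
qed

theorem theorem2:
  fixes t1 :: real
    and A :: "real^'n^'n" and C :: "real^'n^'q" and F :: "real^'n^'r"
  assumes "t1 > 0"
    and "CARD('r) \<le> CARD('n)"
    and "inj (\<lambda>i. row i F)" and "independent (rows F)"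
  shows "(functionally_observable_set t1 C A F
            = output_controllable_set t1 (transpose A) (transpose C) F
          \<longleftrightarrow> perp ((*v) F ` mat_im (obs_gramian t1 C A)) ((*v) F ` mat_ker (obs_gramian t1 C A)))
       \<and> (perp ((*v) F ` mat_im (obs_gramian t1 C A)) ((*v) F ` mat_ker (obs_gramian t1 C A))
          \<longrightarrow> (functionally_observable t1 C A F
               \<longleftrightarrow> output_controllable t1 (transpose A) (transpose C) F))"
proof -
  \<comment> \<open>Once the controllable set is the image under \<open>F\<close> of the range of
    the Gramian, the observable set consists of those of its elements that are orthogonal to the
    image of the kernel. Equality says that all of them are.\<close>
  have "functionally_observable_set t1 C A F = output_controllable_set t1 (transpose A) (transpose C) F
      \<longleftrightarrow> perp ((*v) F ` mat_im (obs_gramian t1 C A)) ((*v) F ` mat_ker (obs_gramian t1 C A))"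
    unfolding output_controllable_set_eq_image_obs_gramian[OF assms(1)]
      functionally_observable_set_def perp_def by blast
  then show ?thesis
    by (auto simp: functionally_observable_def output_controllable_def)
qed

end
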